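(* Let $\mathbf S=(S,\rho_S)$ and $\mathbf F=(F,\rho_F)$ be topological right unosemigroups and let $\alpha:F\times S\to S$ be a $\rho_S$-invertible continuous action of $F$ on $S$. Then the semidirect product $\mathbf S\times_\alpha\mathbf F$ is a ditopological right unosemigroup if and only if both topological right unosemigroups $\mathbf S$ and $\mathbf F$ are ditopological.
   Context: A topological semigroup is a non-empty topological space $S$ endowed with a continuous associative binary operation $\cdot:S\times S\to S$. A right unit operation on $S$ is a map $\rho:S\to S$ with $x\cdot\rho(x)=x$ for all $x\in S$. A topological right unosemigroup $(S,\rho)$ is a topological semigroup $S$ with a continuous right unit operation $\rho$. For $A,B\subset S$ put $B\rightthreetimes A=\{x\in S: xa\in B\text{ for some }a\in A\}$. A continuous right unit operation $\rho$ is dicontinuous if for every $x\in S$ and every neighborhood $O_x\subset S$ of $x$ there are a neighborhood $U_x\subset S$ of $x$ and a neighborhood $W_{\rho(x)}\subset\rho(S)$ of $\rho(x)$ in the subspace $\rho(S)$ such that $(U_x\rightthreetimes W_{\rho(x)})\cap\rho^{-1}(W_{\rho(x)})\subset O_x$. A topological right unosemigroup $(S,\rho)$ is ditopological if $\rho$ is dicontinuous. A continuous action of a topological semigroup $F$ on a topological semigroup $S$ is a continuous map $\alpha:F\times S\to S$ such that for each $f\in F$ the map $\alpha_f:S\to S$, $\alpha_f(x)=\alpha(f,x)$, is a semigroup homomorphism, and $\alpha_{fg}=\alpha_f\circ\alpha_g$ for all $f,g\in F$. The semidirect product $S\times_\alpha F$ is the product space $S\times F$ with the operation $(s,f)\cdot(t,g)=(s\cdot\alpha_f(t),f\cdot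 g)$. The action $\alpha$ is $\rho_S$-invertible if for every $f\in F$ the restriction $\bar\alpha_f=\alpha_f|\rho_S(S)$ is a bijective map of $\rho_S(S)$ onto itself and the map $\alpha^-:F\times\rho_S(S)\to\rho_S(S)$, $\alpha^-(f,s)=\bar\alpha_f^{-1}(s)$, is continuous. In this case $\rho(s,f)=(\bar\alpha_f^{-1}(\rho_S(s)),\rho_F(f))$ is a continuous right unit operation on $S\times_\alpha F$, and $\mathbf S\times_\alpha\mathbf F=(S\times_\alpha F,\rho)$. *)

theory Defs
  imports "HOL-Analysis.Analysis"
begin

(* A topological semigroup is carried by a whole type of class topological_space
   (hence is non-empty); the operation is an explicit parameter, because the
   operation of a semidirect product depends on the action. *)

locale topological_semigroup = semigroup mul
  for mul :: "'a::topological_space \<Rightarrow> 'a \<Rightarrow> 'a" +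
  assumes continuous_mul: "continuous_on UNIV (\<lambda>(x, y). mul x y)"

locale topological_right_unosemigroup = topological_semigroup mul
  for mul :: "'a::topological_space \<Rightarrow> 'a \<Rightarrow> 'a" +
  fixes \<rho> :: "'a \<Rightarrow> 'a"
  assumes right_unit: "mul x (\<rho> x) = x"
    and continuous_right_unit: "continuous_on UNIV \<rho>"

(* Neighborhoods are not required to be open. *)
definition neighborhood_in :: "'a topology \<Rightarrow> 'a \<Rightarrow> 'a set \<Rightarrow> bool" where
  "neighborhood_in X x N \<longleftrightarrow>
     N \<subseteq> topspace X \<and> (\<exists>V. openin X V \<and> x \<in> V \<and> V \<subseteq> N)"

definition right_division :: "('a \<Rightarrow> 'a \<Rightarrow> 'a) \<Rightarrow> 'a set \<Rightarrow> 'a set \<Rightarrow> 'a set" where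
  "right_division mul B A = {x. \<exists>a\<in>A. mul x a \<in> B}"

definition dicontinuous ::
  "('a::topological_space \<Rightarrow> 'a \<Rightarrow> 'a) \<Rightarrow> ('a \<Rightarrow> 'a) \<Rightarrow> bool" where
  "dicontinuous mul \<rho> \<longleftrightarrow>
     (\<forall>x Ox. neighborhood_in euclidean x Ox \<longrightarrow>
        (\<exists>U W. neighborhood_in euclidean x U \<and>
           neighborhood_in (top_of_set (range \<rho>)) (\<rho> x) W \<and>
           right_division mul U W \<inter> \<rho> -` W \<subseteq> Ox))"

locale ditopological_right_unosemigroup = topological_right_unosemigroup mul \<rho>
  for mul :: "'a::topological_space \<Rightarrow> 'a \<Rightarrow> 'a" and \<rho> +
  assumes dicontinuous: "dicontinuous mul \<rho>"

locale continuous_action =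
  F: topological_semigroup mulF + S: topological_semigroup mulS
  for mulF :: "'f::topological_space \<Rightarrow> 'f \<Rightarrow> 'f"
    and mulS :: "'s::topological_space \<Rightarrow> 's \<Rightarrow> 's" +
  fixes \<alpha> :: "'f \<Rightarrow> 's \<Rightarrow> 's"
  assumes continuous_act: "continuous_on UNIV (\<lambda>(f, x). \<alpha> f x)"
    and act_hom: "\<alpha> f (mulS x y) = mulS (\<alpha> f x) (\<alpha> f y)"
    and act_mul: "\<alpha> (mulF f g) = \<alpha> f \<circ> \<alpha> g"

(* Only meaningful on range \<rho>, where \<alpha> f is required to be bijective. *)
definition restricted_inverse :: "('f \<Rightarrow> 's \<Rightarrow> 's) \<Rightarrow> ('s \<Rightarrow> 's) \<Rightarrow> 'f \<Rightarrow> 's \<Rightarrow> 's" where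
  "restricted_inverse \<alpha> \<rho> f = inv_into (range \<rho>) (\<alpha> f)"

definition invertible_action ::
  "('f::topological_space \<Rightarrow> 's::topological_space \<Rightarrow> 's) \<Rightarrow> ('s \<Rightarrow> 's) \<Rightarrow> bool" where
  "invertible_action \<alpha> \<rho> \<longleftrightarrow>
     (\<forall>f. bij_betw (\<alpha> f) (range \<rho>) (range \<rho>)) \<and>
     continuous_on (UNIV \<times> range \<rho>) (\<lambda>(f, s). restricted_inverse \<alpha> \<rho> f s)"

definition semidirect_mul ::
  "('s \<Rightarrow> 's \<Rightarrow> 's) \<Rightarrow> ('f \<Rightarrow> 'f \<Rightarrow> 'f) \<Rightarrow> ('f \<Rightarrow> 's \<Rightarrow> 's) \<Rightarrow>
     's \<times> 'f \<Rightarrow> 's \<times> 'f \<Rightarrow> 's \<times> 'f" where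
  "semidirect_mul mulS mulF \<alpha> = (\<lambda>(s, f) (t, g). (mulS s (\<alpha> f t), mulF f g))"

definition semidirect_unit ::
  "('s \<Rightarrow> 's) \<Rightarrow> ('f \<Rightarrow> 'f) \<Rightarrow> ('f \<Rightarrow> 's \<Rightarrow> 's) \<Rightarrow> 's \<times> 'f \<Rightarrow> 's \<times> 'f" where
  "semidirect_unit \<rho>S \<rho>F \<alpha> = (\<lambda>(s, f). (restricted_inverse \<alpha> \<rho>S f (\<rho>S s), \<rho>F f))"

end

(* For S and F ditopological, control g first: dicontinuity of F brings g so close to f that
   alpha_g carries a neighborhood of the unit into the neighborhood that dicontinuity of S asks
   for. For the converse, alpha_f = alpha_f o alpha_{rho_F f} shows that alpha_b is the identity
   on rho_S(S) for every b in rho_F(F). Hence alpha_g = alpha_{gb} on rho_S(S), so that only the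
   product gb, and not g itself, has to be close to f. *)
theory Submission
  imports Defs
begin

section \<open>Dicontinuity in terms of open sets\<close>

lemma open_boxE:
  assumes "open S" "(x, y) \<in> S"
  obtains A B where "open A" "open B" "x \<in> A" "y \<in> B" "A \<times> B \<subseteq> S"
  using assms by (auto elim: open_prod_elim)

text \<open>Open subsets of \<open>range \<rho>\<close> are traces of open sets of the whole space,
  and every point of \<open>range \<rho>\<close> has the form \<open>\<rho> z\<close>. Quantifying
  over \<open>z\<close> therefore absorbs both the subspace topology and the set
  \<open>right_division\<close>, and neighborhoods can be shrunk to open sets.\<close>

lemma dicontinuous_iff_open:
  fixes \<rho> :: "'a::topological_space \<Rightarrow> 'a"
  shows "dicontinuous mul \<rho> \<longleftrightarrow>
     (\<forall>x G. open G \<longrightarrow> x \<in> G \<longrightarrow>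
        (\<exists>U W. open U \<and> open W \<and> x \<in> U \<and> \<rho> x \<in> W \<and>
           (\<forall>y z. \<rho> z \<in> W \<longrightarrow> \<rho> y \<in> W \<longrightarrow> mul y (\<rho> z) \<in> U \<longrightarrow> y \<in> G)))"
  (is "_ \<longleftrightarrow> ?R")
proof
  assume D: "dicontinuous mul \<rho>"
  show ?R
  proof (intro allI impI)
    fix x and G :: "'a set"
    assume "open G" "x \<in> G"
    then have "neighborhood_in euclidean x G"
      unfolding neighborhood_in_def by auto
    with D obtain U W where "neighborhood_in euclidean x U"
      and "neighborhood_in (top_of_set (range \<rho>)) (\<rho> x) W"
      and sub: "right_division mul U W \<inter> \<rho> -` W \<subseteq> G"
      unfolding dicontinuous_def by blast
    then obtain U' V where U': "open U'" "x \<in> U'" "U' \<subseteq> U"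
      and V: "openin (top_of_set (range \<rho>)) V" "\<rho> x \<in> V" "V \<subseteq> W"
      unfolding neighborhood_in_def by auto
    from V(1) obtain W' where W': "open W'" "V = range \<rho> \<inter> W'"
      unfolding openin_open by auto
    have "y \<in> G" if "\<rho> z \<in> W'" "\<rho> y \<in> W'" "mul y (\<rho> z) \<in> U'" for y z
      using that sub U' V W' unfolding right_division_def by blast
    then show "\<exists>U W. open U \<and> open W \<and> x \<in> U \<and> \<rho> x \<in> W \<and>
        (\<forall>y z. \<rho> z \<in> W \<longrightarrow> \<rho> y \<in> W \<longrightarrow> mul y (\<rho> z) \<in> U \<longrightarrow> y \<in> G)"
      using U' W' V by blast
  qed
next
  assume R: ?R
  show "dicontinuous mul \<rho>"
    unfolding dicontinuous_def
  proof (intro allI impI)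
    fix x :: 'a and N
    assume "neighborhood_in euclidean x N"
    then obtain G where G: "open G" "x \<in> G" "G \<subseteq> N"
      unfolding neighborhood_in_def by auto
    with R obtain U W where UW: "open U" "open W" "x \<in> U" "\<rho> x \<in> W"
      and imp: "\<And>y z. \<rho> z \<in> W \<Longrightarrow> \<rho> y \<in> W \<Longrightarrow> mul y (\<rho> z) \<in> U \<Longrightarrow> y \<in> G"
      by metis
    have "neighborhood_in euclidean x U"
      using UW unfolding neighborhood_in_def by auto
    moreover have "neighborhood_in (top_of_set (range \<rho>)) (\<rho> x) (range \<rho> \<inter> W)"
      using UW unfolding neighborhood_in_def by (auto intro!: exI[of _ "range \<rho> \<inter> W"])
    moreover have "right_division mul U (range \<rho> \<inter> W) \<inter> \<rho> -` (range \<rho> \<inter> W) \<subseteq> N"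
      using imp G unfolding right_division_def by auto
    ultimately show "\<exists>U W. neighborhood_in euclidean x U \<and>
        neighborhood_in (top_of_set (range \<rho>)) (\<rho> x) W \<and>
        right_division mul U W \<inter> \<rho> -` W \<subseteq> N"
      by blast
  qed
qed

lemma dicontinuousE:
  assumes "dicontinuous mul \<rho>" "open G" "x \<in> G"
  obtains U W where "open U" "open W" "x \<in> U" "\<rho> x \<in> W"
    "\<And>y z. \<rho> z \<in> W \<Longrightarrow> \<rho> y \<in> W \<Longrightarrow> mul y (\<rho> z) \<in> U \<Longrightarrow> y \<in> G"
  using assms unfolding dicontinuous_iff_open by metis

lemma dicontinuousI:
  assumes "\<And>x G. open G \<Longrightarrow> x \<in> G \<Longrightarrow>
    \<exists>U W. open U \<and> open W \<and> x \<in> U \<and> \<rho> x \<in> W \<and>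
      (\<forall>y z. \<rho> z \<in> W \<longrightarrow> \<rho> y \<in> W \<longrightarrow> mul y (\<rho> z) \<in> U \<longrightarrow> y \<in> G)"
  shows "dicontinuous mul \<rho>"
  using assms unfolding dicontinuous_iff_open by blast

section \<open>The action on the units, its inverse, and the semidirect product\<close>

locale invertible_semidirect =
  S: topological_right_unosemigroup mulS \<rho>S +
  F: topological_right_unosemigroup mulF \<rho>F +
  act: continuous_action mulF mulS \<alpha>
  for mulS :: "'s::topological_space \<Rightarrow> 's \<Rightarrow> 's" and \<rho>S :: "'s \<Rightarrow> 's"
    and mulF :: "'f::topological_space \<Rightarrow> 'f \<Rightarrow> 'f" and \<rho>F :: "'f \<Rightarrow> 'f"
    and \<alpha> :: "'f \<Rightarrow> 's \<Rightarrow> 's" +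
  assumes invertible: "invertible_action \<alpha> \<rho>S"
begin

abbreviation act_inv :: "'f \<Rightarrow> 's \<Rightarrow> 's" where
  "act_inv \<equiv> restricted_inverse \<alpha> \<rho>S"

abbreviation mul :: "'s \<times> 'f \<Rightarrow> 's \<times> 'f \<Rightarrow> 's \<times> 'f" where
  "mul \<equiv> semidirect_mul mulS mulF \<alpha>"

abbreviation unit :: "'s \<times> 'f \<Rightarrow> 's \<times> 'f" where
  "unit \<equiv> semidirect_unit \<rho>S \<rho>F \<alpha>"

lemma bij_act: "bij_betw (\<alpha> f) (range \<rho>S) (range \<rho>S)"
  using invertible unfolding invertible_action_def by blast

lemma act_range: "e \<in> range \<rho>S \<Longrightarrow> \<alpha> f e \<in> range \<rho>S"
  using bij_act bij_betwE by blast

lemma act_inv_range: "e \<in> range \<rho>S \<Longrightarrow> act_inv f e \<in> range \<rho>S"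
  using bij_act[of f] unfolding restricted_inverse_def bij_betw_def
  by (metis inv_into_into)

lemma act_act_inv: "e \<in> range \<rho>S \<Longrightarrow> \<alpha> f (act_inv f e) = e"
  using bij_act[of f] unfolding restricted_inverse_def
  by (rule bij_betw_inv_into_right)

lemma act_inv_act: "e \<in> range \<rho>S \<Longrightarrow> act_inv f (\<alpha> f e) = e"
  using bij_act[of f] unfolding restricted_inverse_def
  by (rule bij_betw_inv_into_left)

lemma act_unit:
  assumes "e \<in> range \<rho>S"
  shows "\<alpha> (\<rho>F f) e = e"
proof -
  have "\<alpha> f (\<alpha> (\<rho>F f) e) = \<alpha> f e"
    using act.act_mul[of f "\<rho>F f"] by (metis F.right_unit comp_apply)
  \<comment> \<open>Both \<open>e\<close> and \<open>\<alpha> (\<rho>F f) e\<close> lie in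
    \<open>range \<rho>S\<close>, where \<open>\<alpha> f\<close> is injective, so
    \<open>\<alpha> f\<close> cancels.\<close>
  then show ?thesis
    using assms by (metis act_inv_act act_range)
qed

text \<open>The factor \<open>\<rho>F h\<close> fixes the unit \<open>act_inv g e\<close>, which
  \<open>\<alpha> g\<close> then sends to \<open>e\<close>; preimages among the units are unique.
  This lets a condition on the product \<open>mulF g (\<rho>F h)\<close> be read as one on
  \<open>g\<close>.\<close>

lemma act_inv_mul_unit:
  assumes "e \<in> range \<rho>S"
  shows "act_inv (mulF g (\<rho>F h)) e = act_inv g e"
proof -
  have "\<alpha> (mulF g (\<rho>F h)) (act_inv g e) = e"
    using assms by (simp add: act.act_mul act_unit act_inv_range act_act_inv)
  then show ?thesis
    using assms by (metis act_inv_act act_inv_range)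
qed

text \<open>Invertibility controls \<open>act_inv\<close> only on
  \<open>UNIV \<times> range \<rho>S\<close>, hence the side condition on the image of
  \<open>e\<close>.\<close>

lemma continuous_on_act_inv:
  assumes "continuous_on A f" "continuous_on A e" "e ` A \<subseteq> range \<rho>S"
  shows "continuous_on A (\<lambda>x. act_inv (f x) (e x))"
proof -
  have "continuous_on (UNIV \<times> range \<rho>S) (\<lambda>(f, s). act_inv f s)"
    using invertible unfolding invertible_action_def by blast
  from continuous_on_compose2[OF this continuous_on_Pair[OF assms(1,2)]] assms(3)
  show ?thesis by auto
qed

lemma continuous_on_act:
  assumes "continuous_on A f" "continuous_on A e"
  shows "continuous_on A (\<lambda>x. \<alpha> (f x) (e x))"
  using continuous_on_compose2[OF act.continuous_act continuous_on_Pair[OF assms]] by auto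

lemma continuous_on_mulS:
  assumes "continuous_on A f" "continuous_on A e"
  shows "continuous_on A (\<lambda>x. mulS (f x) (e x))"
  using continuous_on_compose2[OF S.continuous_mul continuous_on_Pair[OF assms]] by auto

lemma continuous_on_mulF:
  assumes "continuous_on A f" "continuous_on A e"
  shows "continuous_on A (\<lambda>x. mulF (f x) (e x))"
  using continuous_on_compose2[OF F.continuous_mul continuous_on_Pair[OF assms]] by auto

text \<open>Associativity needs each \<open>\<alpha> f\<close> to be a homomorphism and
  \<open>\<alpha>\<close> to respect products. In \<open>mul x (unit x)\<close> the action undoes
  the inverse in the first coordinate, which leaves the right unit laws of the two factors.\<close>

lemma topological_right_unosemigroup_semidirect:
  "topological_right_unosemigroup mul unit"
proof
  show "mul (mul x y) z = mul x (mul y z)" for x y z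
    by (simp add: semidirect_mul_def split_beta act.act_hom act.act_mul S.assoc F.assoc)
  show "mul x (unit x) = x" for x
    by (simp add: semidirect_mul_def semidirect_unit_def split_beta
        act_act_inv S.right_unit F.right_unit)
  show "continuous_on UNIV (\<lambda>(x, y). mul x y)"
    unfolding semidirect_mul_def split_beta
    by (intro continuous_on_Pair continuous_on_mulS continuous_on_mulF continuous_on_act
        continuous_intros)
  show "continuous_on UNIV unit"
    unfolding semidirect_unit_def split_beta
    by (intro continuous_on_Pair continuous_on_act_inv continuous_intros
        continuous_on_compose2[OF S.continuous_right_unit]
        continuous_on_compose2[OF F.continuous_right_unit]) auto
qed

section \<open>Dicontinuity passes from the factors to the product\<close>

lemma dicontinuous_semidirect:
  assumes DS: "dicontinuous mulS \<rho>S" and DF: "dicontinuous mulF \<rho>F"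
  shows "dicontinuous mul unit"
proof (rule dicontinuousI)
  fix x and G :: "('s \<times> 'f) set"
  assume G: "open G" "x \<in> G"
  obtain s f where x: "x = (s, f)" by force
  from G[unfolded x] obtain GS GF where GS: "open GS" "s \<in> GS"
    and GF: "open GF" "f \<in> GF" and sub: "GS \<times> GF \<subseteq> G"
    by (rule open_boxE)
  from DS GS obtain US WS where US: "open US" "s \<in> US" and WS: "open WS" "\<rho>S s \<in> WS"
    and S: "\<And>y z. \<rho>S z \<in> WS \<Longrightarrow> \<rho>S y \<in> WS \<Longrightarrow> mulS y (\<rho>S z) \<in> US \<Longrightarrow> y \<in> GS"
    by (rule dicontinuousE) blast
  \<comment> \<open>\<open>?u\<close> is the first coordinate of \<open>unit x\<close>, and
    \<open>\<alpha> f ?u = \<rho>S s\<close> lies in \<open>WS\<close>. Continuity of the action at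
    \<open>(f, ?u)\<close> gives a box \<open>A \<times> B\<close> that is mapped into
    \<open>WS\<close>.\<close>
  let ?u = "act_inv f (\<rho>S s)"
  have "open ((\<lambda>(f, e). \<alpha> f e) -` WS)"
    using act.continuous_act WS(1) by (rule open_vimage[rotated])
  moreover have "(f, ?u) \<in> (\<lambda>(f, e). \<alpha> f e) -` WS"
    using WS by (simp add: act_act_inv)
  ultimately obtain A B where A: "open A" "f \<in> A" and B: "open B" "?u \<in> B"
    and AB: "A \<times> B \<subseteq> (\<lambda>(f, e). \<alpha> f e) -` WS"
    by (rule open_boxE)
  \<comment> \<open>The target for \<open>F\<close> is cut down by \<open>A\<close>, so that the
    \<open>g\<close> obtained below also carries \<open>B\<close> into \<open>WS\<close>.\<close>
  from GF A have "open (GF \<inter> A)" "f \<in> GF \<inter> A" by auto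
  with DF obtain UF WF where UF: "open UF" "f \<in> UF" and WF: "open WF" "\<rho>F f \<in> WF"
    and F: "\<And>y z. \<rho>F z \<in> WF \<Longrightarrow> \<rho>F y \<in> WF \<Longrightarrow> mulF y (\<rho>F z) \<in> UF \<Longrightarrow> y \<in> GF \<inter> A"
    by (rule dicontinuousE) blast
  have "y \<in> G" if z: "unit z \<in> B \<times> WF" and y: "unit y \<in> B \<times> WF"
    and yz: "mul y (unit z) \<in> US \<times> UF" for y z
  proof -
    obtain t g where yeq: "y = (t, g)" by force
    obtain r h where zeq: "z = (r, h)" by force
    let ?a = "act_inv h (\<rho>S r)" and ?b = "act_inv g (\<rho>S t)"
    have a: "?a \<in> B" "\<rho>F h \<in> WF" and b: "?b \<in> B" "\<rho>F g \<in> WF"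
      and U: "mulS t (\<alpha> g ?a) \<in> US" "mulF g (\<rho>F h) \<in> UF"
      using z y yz by (simp_all add: yeq zeq semidirect_unit_def semidirect_mul_def)
    from a b U have g: "g \<in> GF" "g \<in> A" using F by blast+
    \<comment> \<open>Applying \<open>\<alpha> g\<close> to both first coordinates yields two units
      of \<open>S\<close> in \<open>WS\<close>: \<open>\<rho>S t\<close> itself, and some
      \<open>\<rho>S q\<close> with \<open>mulS t (\<rho>S q) \<in> US\<close>. This is the
      situation that dicontinuity of \<open>S\<close> handles.\<close>
    have "\<alpha> g ?a \<in> WS" "\<alpha> g ?b \<in> WS" using g a b AB by auto
    moreover have "\<alpha> g ?b = \<rho>S t" by (simp add: act_act_inv)
    moreover obtain q where "\<alpha> g ?a = \<rho>S q" using act_range act_inv_range by blast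
    ultimately have "t \<in> GS" using S U by metis
    with g sub yeq show "y \<in> G" by auto
  qed
  moreover have "open (US \<times> UF)" "open (B \<times> WF)" "x \<in> US \<times> UF" "unit x \<in> B \<times> WF"
    using US UF WF B by (auto simp: x semidirect_unit_def intro: open_Times)
  ultimately show "\<exists>U W. open U \<and> open W \<and> x \<in> U \<and> unit x \<in> W \<and>
      (\<forall>y z. unit z \<in> W \<longrightarrow> unit y \<in> W \<longrightarrow> mul y (unit z) \<in> U \<longrightarrow> y \<in> G)"
    by (intro exI[of _ "US \<times> UF"] exI[of _ "B \<times> WF"]) simp
qed

section \<open>Dicontinuity passes from the product to the factors\<close>

lemma dicontinuous_semidirectE:
  assumes "dicontinuous mul unit" "open G" "(s, f) \<in> G"
  obtains US UF WS WF where "open US" "open UF" "open WS" "open WF"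
    "s \<in> US" "f \<in> UF" "act_inv f (\<rho>S s) \<in> WS" "\<rho>F f \<in> WF"
    "\<And>t g a h. a \<in> range \<rho>S \<Longrightarrow> a \<in> WS \<Longrightarrow> act_inv g (\<rho>S t) \<in> WS \<Longrightarrow>
       \<rho>F h \<in> WF \<Longrightarrow> \<rho>F g \<in> WF \<Longrightarrow> mulS t (\<alpha> g a) \<in> US \<Longrightarrow> mulF g (\<rho>F h) \<in> UF \<Longrightarrow>
       (t, g) \<in> G"
proof -
  from assms obtain U W where U: "open U" "(s, f) \<in> U" and W: "open W" "unit (s, f) \<in> W"
    and imp: "\<And>y z. unit z \<in> W \<Longrightarrow> unit y \<in> W \<Longrightarrow> mul y (unit z) \<in> U \<Longrightarrow> y \<in> G"
    by (rule dicontinuousE) blast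
  from U obtain US UF where *: "open US" "open UF" "s \<in> US" "f \<in> UF" "US \<times> UF \<subseteq> U"
    by (rule open_boxE)
  from W[unfolded semidirect_unit_def prod.case]
  obtain WS WF where **: "open WS" "open WF" "act_inv f (\<rho>S s) \<in> WS" "\<rho>F f \<in> WF"
    "WS \<times> WF \<subseteq> W"
    by (rule open_boxE)
  have "(t, g) \<in> G"
    if a: "a \<in> range \<rho>S" "a \<in> WS" and t: "act_inv g (\<rho>S t) \<in> WS"
      and h: "\<rho>F h \<in> WF" and g: "\<rho>F g \<in> WF"
      and m: "mulS t (\<alpha> g a) \<in> US" "mulF g (\<rho>F h) \<in> UF" for t g a h
  proof -
    \<comment> \<open>As \<open>\<alpha> h\<close> permutes the units, every unit \<open>a\<close>
      is the first coordinate of some \<open>unit (r, h)\<close>. Hence \<open>a\<close> and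
      \<open>h\<close> can be chosen independently of each other.\<close>
    obtain r where "\<alpha> h a = \<rho>S r" using act_range[OF a(1)] by blast
    then have r: "unit (r, h) = (a, \<rho>F h)"
      using act_inv_act[OF a(1), of h] by (simp add: semidirect_unit_def)
    show ?thesis
    proof (rule imp)
      show "unit (r, h) \<in> W" using r a h ** by auto
      show "unit (t, g) \<in> W" using t g ** by (auto simp: semidirect_unit_def)
      show "mul (t, g) (unit (r, h)) \<in> U" using r m * by (auto simp: semidirect_mul_def)
    qed
  qed
  then show ?thesis
    by (rule that[OF *(1,2) **(1,2) *(3,4) **(3,4)])
qed

text \<open>It suffices to look at the slice over one arbitrary point \<open>f\<close>. With
  \<open>g = h = f\<close> the condition in \<open>F\<close> holds by
  \<open>mulF f (\<rho>F f) = f\<close>, and \<open>\<alpha> f\<close> relates the units of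
  \<open>S\<close> to the first coordinates of units of the product.\<close>

lemma dicontinuous_left_factor:
  assumes "dicontinuous mul unit"
  shows "dicontinuous mulS \<rho>S"
proof (rule dicontinuousI)
  fix s and G :: "'s set" and f :: 'f
  assume "open G" "s \<in> G"
  then have G: "open (G \<times> (UNIV :: 'f set))" "(s, f) \<in> G \<times> UNIV"
    by (auto intro: open_Times)
  from assms G obtain US UF WS WF where o: "open US" "open WS"
    and m: "s \<in> US" "f \<in> UF" "act_inv f (\<rho>S s) \<in> WS" "\<rho>F f \<in> WF"
    and imp: "\<And>t g a h. a \<in> range \<rho>S \<Longrightarrow> a \<in> WS \<Longrightarrow> act_inv g (\<rho>S t) \<in> WS \<Longrightarrow>
       \<rho>F h \<in> WF \<Longrightarrow> \<rho>F g \<in> WF \<Longrightarrow> mulS t (\<alpha> g a) \<in> US \<Longrightarrow> mulF g (\<rho>F h) \<in> UF \<Longrightarrow>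
       (t, g) \<in> G \<times> UNIV"
    by (rule dicontinuous_semidirectE) blast
  have "continuous_on (range \<rho>S) (act_inv f)"
    by (intro continuous_on_act_inv continuous_intros) auto
  \<comment> \<open>\<open>act_inv f\<close> is continuous only on the units, so \<open>V\<close> is
    an ambient open set whose trace there is the preimage of \<open>WS\<close>.\<close>
  then obtain V where V: "open V" "V \<inter> range \<rho>S = act_inv f -` WS \<inter> range \<rho>S"
    using o(2) unfolding continuous_on_open_invariant by metis
  have "t \<in> G" if "\<rho>S r \<in> V" "\<rho>S t \<in> V" "mulS t (\<rho>S r) \<in> US" for t r
  proof -
    have "act_inv f (\<rho>S r) \<in> WS" "act_inv f (\<rho>S t) \<in> WS" using that V by blast+
    \<comment> \<open>The choice \<open>a = act_inv f (\<rho>S r)\<close> turns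
      \<open>\<alpha> f a\<close> back into \<open>\<rho>S r\<close>.\<close>
    moreover have "mulS t (\<alpha> f (act_inv f (\<rho>S r))) \<in> US"
      using that by (simp add: act_act_inv)
    moreover have "mulF f (\<rho>F f) \<in> UF" using m by (simp add: F.right_unit)
    ultimately have "(t, f) \<in> G \<times> UNIV"
      using imp[of "act_inv f (\<rho>S r)" f t f] m(4) act_inv_range by blast
    then show ?thesis by simp
  qed
  moreover have "\<rho>S s \<in> V" using V m by blast
  ultimately show "\<exists>U W. open U \<and> open W \<and> s \<in> U \<and> \<rho>S s \<in> W \<and>
      (\<forall>y z. \<rho>S z \<in> W \<longrightarrow> \<rho>S y \<in> W \<longrightarrow> mulS y (\<rho>S z) \<in> U \<longrightarrow> y \<in> G)"
    using o(1) m(1) V(1) by blast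
qed

text \<open>Here the first coordinate is frozen at an arbitrary \<open>s\<close>. With
  \<open>a = act_inv g (\<rho>S s)\<close> the product in \<open>S\<close> is
  \<open>mulS s (\<rho>S s) = s\<close>, so the remaining condition in \<open>S\<close> is that this
  \<open>a\<close> lies in \<open>WS\<close>.\<close>

lemma dicontinuous_right_factor:
  assumes "dicontinuous mul unit"
  shows "dicontinuous mulF \<rho>F"
proof (rule dicontinuousI)
  fix f and G :: "'f set" and s :: 's
  assume "open G" "f \<in> G"
  then have G: "open ((UNIV :: 's set) \<times> G)" "(s, f) \<in> UNIV \<times> G"
    by (auto intro: open_Times)
  from assms G obtain US UF WS WF where o: "open UF" "open WS" "open WF"
    and m: "s \<in> US" "f \<in> UF" "act_inv f (\<rho>S s) \<in> WS" "\<rho>F f \<in> WF"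
    and imp: "\<And>t g a h. a \<in> range \<rho>S \<Longrightarrow> a \<in> WS \<Longrightarrow> act_inv g (\<rho>S t) \<in> WS \<Longrightarrow>
       \<rho>F h \<in> WF \<Longrightarrow> \<rho>F g \<in> WF \<Longrightarrow> mulS t (\<alpha> g a) \<in> US \<Longrightarrow> mulF g (\<rho>F h) \<in> UF \<Longrightarrow>
       (t, g) \<in> UNIV \<times> G"
    by (rule dicontinuous_semidirectE) blast
  \<comment> \<open>\<open>?V\<close> collects the \<open>g\<close> that meet this condition. It is
    imposed on the product \<open>mulF g (\<rho>F h)\<close>, since dicontinuity bounds that product
    and not \<open>g\<close>; \<open>act_inv_mul_unit\<close> then transfers membership in
    \<open>?V\<close> to \<open>g\<close>.\<close>
  let ?V = "(\<lambda>g. act_inv g (\<rho>S s)) -` WS"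
  have "continuous_on UNIV (\<lambda>g. act_inv g (\<rho>S s))"
    by (intro continuous_on_act_inv continuous_intros) auto
  then have V: "open ?V" using o(2) by (rule open_vimage[rotated])
  have "g \<in> G" if "\<rho>F h \<in> WF" "\<rho>F g \<in> WF" "mulF g (\<rho>F h) \<in> UF \<inter> ?V" for g h
  proof -
    have "act_inv g (\<rho>S s) \<in> WS" using that by (simp add: act_inv_mul_unit)
    moreover have "mulS s (\<alpha> g (act_inv g (\<rho>S s))) \<in> US"
      using m by (simp add: act_act_inv S.right_unit)
    ultimately have "(s, g) \<in> UNIV \<times> G"
      using imp[of "act_inv g (\<rho>S s)" g s h] that act_inv_range by blast
    then show ?thesis by simp
  qed
  moreover have "open (UF \<inter> ?V)" "f \<in> UF \<inter> ?V" using o V m by auto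
  ultimately show "\<exists>U W. open U \<and> open W \<and> f \<in> U \<and> \<rho>F f \<in> W \<and>
      (\<forall>y z. \<rho>F z \<in> W \<longrightarrow> \<rho>F y \<in> W \<longrightarrow> mulF y (\<rho>F z) \<in> U \<longrightarrow> y \<in> G)"
    using o(3) m(4) by blast
qed

end

theorem theorem8:
  fixes mulS :: "'s::topological_space \<Rightarrow> 's \<Rightarrow> 's" and \<rho>S :: "'s \<Rightarrow> 's"
    and mulF :: "'f::topological_space \<Rightarrow> 'f \<Rightarrow> 'f" and \<rho>F :: "'f \<Rightarrow> 'f"
    and \<alpha> :: "'f \<Rightarrow> 's \<Rightarrow> 's"
  assumes "topological_right_unosemigroup mulS \<rho>S"
    and "topological_right_unosemigroup mulF \<rho>F"
    and "continuous_action mulF mulS \<alpha>"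
    and "invertible_action \<alpha> \<rho>S"
  shows "ditopological_right_unosemigroup
           (semidirect_mul mulS mulF \<alpha>) (semidirect_unit \<rho>S \<rho>F \<alpha>)
         \<longleftrightarrow> ditopological_right_unosemigroup mulS \<rho>S
           \<and> ditopological_right_unosemigroup mulF \<rho>F"
proof -
  interpret invertible_semidirect mulS \<rho>S mulF \<rho>F \<alpha>
    using assms by (intro invertible_semidirect.intro invertible_semidirect_axioms.intro)
  \<comment> \<open>Both factors and the product are topological right unosemigroups, so only
    dicontinuity is left to compare.\<close>
  have "dicontinuous mul unit \<longleftrightarrow> dicontinuous mulS \<rho>S \<and> dicontinuous mulF \<rho>F"
    using dicontinuous_semidirect dicontinuous_left_factor dicontinuous_right_factor by blast
  then show ?thesis
    using assms(1,2) topological_right_unosemigroup_semidirect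
    by (simp add: ditopological_right_unosemigroup_def ditopological_right_unosemigroup_axioms_def)
qed

end
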